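(* Let $D\subset\mathbb{C}$ be a domain and let $F$ be an analytic function on $D$ of the form $F=f^2$ with $f$ analytic on $D$, such that $|F'(z)|\neq 1$ for all $z\in D$. Let $M$ be the modular surface in $\mathbb{E}_1^3$ induced by $F$, and suppose that the Gaussian curvature $K$ of $M$ vanishes identically on $D$. Then $$F(z)=\exp(mz+n)\quad\text{or}\quad F(z)=(mz+n)^{1+il},$$ for some $m,n\in\mathbb{C}$ and $l\in\mathbb{R}$.
   Context: $\mathbb{E}_1^3$ denotes $\mathbb{R}^3$ with the Lorentzian metric $dx^2+dy^2-dt^2$. A domain is an open connected subset of $\mathbb{C}$, and $(x,y)\in\mathbb{R}^2$ is identified with $z=x+iy$. The modular surface induced (generated) by an analytic function $F$ on a domain $D$ is the graph $M(x,y)=(x,y,h(x,y))$, $z=x+iy\in D$, with $h=|F|$. One has $h_x^2+h_y^2=|F'|^2$, and the surface is called non-degenerate if $|F'|\neq 1$. Its Gaussian curvature in $\mathbb{E}_1^3$ is $$K=-\frac{h_{xx}h_{yy}-h_{xy}^2}{(1-h_x^2-h_y^2)^2}.$$ With $F=f^2$ this equals $-\dfrac{4(|f'|^4-|ff''|^2)}{(1-4|ff'|^2)^2}$. The expression $(mz+n)^{1+il}$ is understood as an analytic function on $D$ given by a branch of the complex power. *)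

theory Defs
  imports "HOL-Analysis.Analysis"
begin

definition lorentz :: "real^3 \<Rightarrow> real^3 \<Rightarrow> real" where
  "lorentz u v = u$1 * v$1 + u$2 * v$2 - u$3 * v$3"

text \<open>The Lorentzian cross product, characterised by
  \<open>lorentz (lorentz_cross u v) w = det [u, v, w]\<close>; it is Lorentz-orthogonal to both factors.\<close>

definition lorentz_cross :: "real^3 \<Rightarrow> real^3 \<Rightarrow> real^3" where
  "lorentz_cross u v = vector [cross3 u v $ 1, cross3 u v $ 2, - (cross3 u v $ 3)]"

text \<open>Partial derivatives in \<open>x\<close> and \<open>y\<close> of a function of \<open>z = x + \<i> y\<close>.\<close>

definition partial_x :: "(complex \<Rightarrow> 'a::real_normed_vector) \<Rightarrow> complex \<Rightarrow> 'a" where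
  "partial_x X z = vector_derivative (\<lambda>t. X (z + of_real t)) (at 0)"

definition partial_y :: "(complex \<Rightarrow> 'a::real_normed_vector) \<Rightarrow> complex \<Rightarrow> 'a" where
  "partial_y X z = vector_derivative (\<lambda>t. X (z + \<i> * of_real t)) (at 0)"

definition unit_normal :: "(complex \<Rightarrow> real^3) \<Rightarrow> complex \<Rightarrow> real^3" where
  "unit_normal X z =
     (let n = lorentz_cross (partial_x X z) (partial_y X z)
      in (1 / sqrt \<bar>lorentz n n\<bar>) *\<^sub>R n)"

text \<open>Gaussian curvature in \<open>E\<^sub>1\<^sup>3\<close> of a parametrised non-degenerate surface \<open>X\<close>. The factor
  \<open>lorentz n n\<close>, which is \<open>-1\<close> for spacelike and \<open>1\<close> for timelike surfaces, is part of the
  Gauss equation in Lorentzian space; the choice of sign of \<open>n\<close> is irrelevant.\<close>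

definition gauss_curvature :: "(complex \<Rightarrow> real^3) \<Rightarrow> complex \<Rightarrow> real" where
  "gauss_curvature X z =
     (let Xx = partial_x X; Xy = partial_y X; n = unit_normal X z;
          E = lorentz (Xx z) (Xx z); F = lorentz (Xx z) (Xy z); G = lorentz (Xy z) (Xy z);
          L = lorentz (partial_x Xx z) n; M = lorentz (partial_y Xx z) n;
          N = lorentz (partial_y Xy z) n
      in lorentz n n * (L * N - M\<^sup>2) / (E * G - F\<^sup>2))"

definition graph_surface :: "(complex \<Rightarrow> real) \<Rightarrow> complex \<Rightarrow> real^3" where
  "graph_surface h z = vector [Re z, Im z, h z]"

definition modular_surface :: "(complex \<Rightarrow> complex) \<Rightarrow> complex \<Rightarrow> real^3" where
  "modular_surface F = graph_surface (\<lambda>z. cmod (F z))"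

text \<open>All values of the multivalued power \<open>w\<^sup>a\<close>. At \<open>w = 0\<close> the convention \<open>0\<^sup>a = 0\<close> of
  \<^const>\<open>powr\<close> is used, which is the natural one when \<open>Re a > 0\<close>.\<close>

definition cpower_values :: "complex \<Rightarrow> complex \<Rightarrow> complex set" where
  "cpower_values w a = (if w = 0 then {0} else {exp (a * u) |u. exp u = w})"

text \<open>A branch of \<open>g\<^sup>a\<close> on \<open>D\<close> is an analytic selection of its values. No single-valued
  logarithm of \<open>g\<close> on all of \<open>D\<close> is demanded: \<open>z\<close> is a branch of \<open>z\<^sup>1\<close> on every domain.\<close>

definition power_branch_on ::
    "complex set \<Rightarrow> (complex \<Rightarrow> complex) \<Rightarrow> complex \<Rightarrow> (complex \<Rightarrow> complex) \<Rightarrow> bool" where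
  "power_branch_on D g a P \<longleftrightarrow> P analytic_on D \<and> (\<forall>z\<in>D. P z \<in> cpower_values (g z) a)"

text \<open>For graphs, \<^const>\<open>gauss_curvature\<close> is the usual expression in the partial derivatives of
  the height function.\<close>

lemma has_vector_derivative_vector3:
  assumes "(f has_vector_derivative a) (at x)" "(g has_vector_derivative b) (at x)"
    "(h has_vector_derivative c) (at x)"
  shows "((\<lambda>t. vector [f t, g t, h t] :: real^3) has_vector_derivative vector [a, b, c]) (at x)"
proof -
  have *: "(vector [p, q, r] :: real^3) = p *\<^sub>R axis 1 1 + q *\<^sub>R axis 2 1 + r *\<^sub>R axis 3 1"
    for p q r :: real
    by (simp add: vec_eq_iff forall_3 axis_def)
  show ?thesis
    unfolding * using assms
    by (auto intro!: derivative_eq_intros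
        simp: has_real_derivative_iff_has_vector_derivative[symmetric])
qed

lemma slices_at_0:
  fixes z :: complex
  assumes "open D" "z \<in> D"
  shows "\<forall>\<^sub>F t in nhds 0. z + of_real t \<in> D" "\<forall>\<^sub>F t in nhds 0. z + \<i> * of_real t \<in> D"
proof -
  have 1: "open ((\<lambda>t::real. z + of_real t) -` D)" "open ((\<lambda>t::real. z + \<i> * of_real t) -` D)"
    by (intro open_vimage assms continuous_intros)+
  show "\<forall>\<^sub>F t in nhds 0. z + of_real t \<in> D"
    using eventually_nhds_in_open[OF 1(1), of 0] assms by simp
  show "\<forall>\<^sub>F t in nhds 0. z + \<i> * of_real t \<in> D"
    using eventually_nhds_in_open[OF 1(2), of 0] assms by simp
qed

lemma partial_cong:
  assumes "open D" "z \<in> D" "\<And>w. w \<in> D \<Longrightarrow> X w = Y w"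
  shows "partial_x X z = partial_x Y z" "partial_y X z = partial_y Y z"
proof -
  have "\<forall>\<^sub>F t in nhds 0. X (z + of_real t) = Y (z + of_real t)"
    using slices_at_0(1)[OF assms(1,2)] by eventually_elim (rule assms(3))
  then show "partial_x X z = partial_x Y z"
    unfolding partial_x_def by (intro vector_derivative_cong_eq) auto
  have "\<forall>\<^sub>F t in nhds 0. X (z + \<i> * of_real t) = Y (z + \<i> * of_real t)"
    using slices_at_0(2)[OF assms(1,2)] by eventually_elim (rule assms(3))
  then show "partial_y X z = partial_y Y z"
    unfolding partial_y_def by (intro vector_derivative_cong_eq) auto
qed

definition partially_differentiable_on :: "(complex \<Rightarrow> real) \<Rightarrow> complex set \<Rightarrow> bool" where
  "partially_differentiable_on h D \<longleftrightarrow>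
     (\<forall>z\<in>D. (\<lambda>t. h (z + of_real t)) differentiable (at 0) \<and>
            (\<lambda>t. h (z + \<i> * of_real t)) differentiable (at 0))"

lemma partials_vector3:
  assumes "partially_differentiable_on h D" "z \<in> D"
  shows "partial_x (graph_surface h) z = vector [1, 0, partial_x h z]"
    "partial_y (graph_surface h) z = vector [0, 1, partial_y h z]"
    "partial_x (\<lambda>w. vector [p, q, h w] :: real^3) z = vector [0, 0, partial_x h z]"
    "partial_y (\<lambda>w. vector [p, q, h w] :: real^3) z = vector [0, 0, partial_y h z]"
proof -
  have d: "((\<lambda>t. h (z + of_real t)) has_vector_derivative partial_x h z) (at 0)"
    "((\<lambda>t. h (z + \<i> * of_real t)) has_vector_derivative partial_y h z) (at 0)"
    using assms unfolding partially_differentiable_on_def partial_x_def partial_y_def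
    by (auto simp: vector_derivative_works)
  have c: "((\<lambda>t. p) has_vector_derivative 0) (at (0::real))" 
     "((\<lambda>t. p + t) has_vector_derivative 1) (at (0::real))" for p :: real
    by (auto intro!: derivative_eq_intros)
  show "partial_x (graph_surface h) z = vector [1, 0, partial_x h z]"
    unfolding partial_x_def[of "graph_surface h"] graph_surface_def
    by (rule vector_derivative_at) (use has_vector_derivative_vector3[OF c(2) c(1) d(1)] in simp)
  show "partial_y (graph_surface h) z = vector [0, 1, partial_y h z]"
    unfolding partial_y_def[of "graph_surface h"] graph_surface_def
    by (rule vector_derivative_at) (use has_vector_derivative_vector3[OF c(1) c(2) d(2)] in simp)
  show "partial_x (\<lambda>w. vector [p, q, h w] :: real^3) z = vector [0, 0, partial_x h z]"
    unfolding partial_x_def[of "\<lambda>w. vector [p, q, h w]"]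
    by (rule vector_derivative_at) (rule has_vector_derivative_vector3[OF c(1) c(1) d(1)])
  show "partial_y (\<lambda>w. vector [p, q, h w] :: real^3) z = vector [0, 0, partial_y h z]"
    unfolding partial_y_def[of "\<lambda>w. vector [p, q, h w]"]
    by (rule vector_derivative_at) (rule has_vector_derivative_vector3[OF c(1) c(1) d(2)])
qed

lemma gauss_curvature_graph:
  assumes "open D" "z \<in> D" "partially_differentiable_on h D"
    "partially_differentiable_on (partial_x h) D" "partially_differentiable_on (partial_y h) D"
    and nondeg: "(partial_x h z)\<^sup>2 + (partial_y h z)\<^sup>2 \<noteq> 1"
  shows "gauss_curvature (graph_surface h) z =
    - (partial_x (partial_x h) z * partial_y (partial_y h) z - (partial_y (partial_x h) z)\<^sup>2)
      / (1 - (partial_x h z)\<^sup>2 - (partial_y h z)\<^sup>2)\<^sup>2"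
proof -
  let ?X = "graph_surface h"
  define a b where "a = partial_x h z" and "b = partial_y h z"
  define p q r where "p = partial_x (partial_x h) z" and "q = partial_y (partial_x h) z"
    and "r = partial_y (partial_y h) z"
  define W where "W = a\<^sup>2 + b\<^sup>2 - 1"
  have W: "W \<noteq> 0" using nondeg by (simp add: W_def a_def b_def)
  have X1: "partial_x ?X z = vector [1, 0, a]" "partial_y ?X z = vector [0, 1, b]"
    using partials_vector3[OF assms(3,2)] by (simp_all add: a_def b_def)
  have X2: "partial_x (partial_x ?X) z = vector [0, 0, p]"
    "partial_y (partial_x ?X) z = vector [0, 0, q]"
    "partial_y (partial_y ?X) z = vector [0, 0, r]"
    using partial_cong[OF assms(1,2), of "partial_x ?X" "\<lambda>w. vector [1, 0, partial_x h w]"]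
      partial_cong[OF assms(1,2), of "partial_y ?X" "\<lambda>w. vector [0, 1, partial_y h w]"]
      partials_vector3[OF assms(3)] partials_vector3(3,4)[OF assms(4,2)]
      partials_vector3(3,4)[OF assms(5,2)]
    by (simp_all add: p_def q_def r_def)
  define s where "s = 1 / sqrt \<bar>W\<bar>"
  have n: "unit_normal ?X z = s *\<^sub>R vector [-a, -b, -1]"
    by (simp add: unit_normal_def X1 lorentz_cross_def cross3_def lorentz_def s_def W_def
        power2_eq_square)
  have s: "s\<^sup>2 = 1 / \<bar>W\<bar>" by (simp add: s_def power_divide)
  have "gauss_curvature ?X z = (s\<^sup>2 * W) * (s\<^sup>2 * (p * r - q\<^sup>2)) / (- W)"
    unfolding gauss_curvature_def Let_def n X1 X2
    by (simp add: lorentz_def W_def power2_eq_square algebra_simps)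
  also have "\<dots> = - (p * r - q\<^sup>2) / W\<^sup>2"
    using W unfolding s by (simp add: field_simps power2_eq_square)
  also have "W\<^sup>2 = (1 - a\<^sup>2 - b\<^sup>2)\<^sup>2"
    by (simp add: W_def power2_eq_square algebra_simps)
  finally show ?thesis by (simp add: a_def b_def p_def q_def r_def)
qed

end

theory Submission
  imports Defs "HOL-Complex_Analysis.Complex_Analysis"
begin

text \<open>
  With \<open>F = f\<^sup>2\<close> the height of the surface is \<open>\<bar>F\<bar> = f \<bullet> f\<close>, the real inner product of \<open>f\<close> with
  itself, and its Hessian determinant is \<open>4 (\<bar>f'\<bar>\<^sup>4 - \<bar>f f''\<bar>\<^sup>2)\<close>
  (\<open>gauss_curvature_modular_surface_square\<close>). So flatness means \<open>\<bar>f'\<bar>\<^sup>2 = \<bar>f f''\<bar>\<close>. If \<open>f'\<close> vanishes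
  identically, \<open>F\<close> is constant, which is a degenerate exponential or, for the constant 0, a power
  of the base 0. Otherwise, on a disc on which \<open>f'\<close> has no zero, the holomorphic
  function \<open>f f'' / f'\<^sup>2\<close> has modulus 1 and hence is a constant \<open>c\<close>. Because
  \<open>(f / f')' = 1 - f f'' / f'\<^sup>2\<close>, this integrates to \<open>f = ((1 - c) z + d) f'\<close>, an identity between
  holomorphic functions that extends from the disc to all of \<open>D\<close> (\<open>eq_linear_mult_deriv\<close>). For \<open>F\<close>
  it reads \<open>((1 - c) z + d) F' = 2 F\<close>, a first-order linear equation.

  If \<open>c = 1\<close>, its solutions are exponentials (\<open>solution_is_exponential\<close>). If \<open>c \<noteq> 1\<close>, they are
  constant multiples of powers of \<open>(1 - c) z + d\<close> with exponent \<open>2 / (1 - c)\<close>, and the constant can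
  be absorbed into the base (\<open>solution_is_power_branch\<close>). The exponent has real part 1 because the
  map \<open>c \<mapsto> 2 / (1 - c)\<close> sends the unit circle without 1 to the line \<open>Re = 1\<close>.

  The delicate point is that \<open>D\<close> need not be simply connected and may wind around the zero of the
  base, so that the base can fail to have a logarithm on \<open>D\<close>. That the values of \<open>F\<close> are values of the
  power is therefore shown as a property of points, which the equation carries from point to point
  through small discs (\<open>power_branch_propagates\<close>).
\<close>

section \<open>The curvature of a modular surface\<close>

lemma has_vector_derivative_slices:
  fixes f :: "complex \<Rightarrow> complex"
  assumes "(f has_field_derivative f') (at z)"
  shows "((\<lambda>t. f (z + of_real t)) has_vector_derivative f') (at 0)"
    and "((\<lambda>t. f (z + \<i> * of_real t)) has_vector_derivative \<i> * f') (at 0)"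
proof -
  have "((\<lambda>t. z + of_real t) has_vector_derivative 1) (at 0)"
    and "((\<lambda>t. z + \<i> * of_real t) has_vector_derivative \<i>) (at 0)"
    by (auto intro!: derivative_eq_intros)
  from this[THEN field_vector_diff_chain_at, of f f']
  show "((\<lambda>t. f (z + of_real t)) has_vector_derivative f') (at 0)"
    and "((\<lambda>t. f (z + \<i> * of_real t)) has_vector_derivative \<i> * f') (at 0)"
    using assms by (simp_all add: o_def)
qed

lemma partials_inner:
  fixes f g :: "complex \<Rightarrow> complex"
  assumes "open D" "f holomorphic_on D" "g holomorphic_on D"
  shows "z \<in> D \<Longrightarrow> partial_x (\<lambda>w. f w \<bullet> g w) z = f z \<bullet> deriv g z + deriv f z \<bullet> g z"
    and "z \<in> D \<Longrightarrow> partial_y (\<lambda>w. f w \<bullet> g w) z = f z \<bullet> (\<i> * deriv g z) + (\<i> * deriv f z) \<bullet> g z"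
    and "partially_differentiable_on (\<lambda>w. f w \<bullet> g w) D"
proof -
  have d: "(f has_field_derivative deriv f z) (at z)" "(g has_field_derivative deriv g z) (at z)"
    if "z \<in> D" for z
    using assms that by (auto intro: holomorphic_derivI)
  have x: "((\<lambda>t. f (z + of_real t) \<bullet> g (z + of_real t)) has_vector_derivative
      f z \<bullet> deriv g z + deriv f z \<bullet> g z) (at 0)" if "z \<in> D" for z
    using has_derivative_inner[OF
        has_vector_derivative_slices(1)[OF d(1)[OF that], unfolded has_vector_derivative_def]
        has_vector_derivative_slices(1)[OF d(2)[OF that], unfolded has_vector_derivative_def]]
    by (simp add: has_vector_derivative_def algebra_simps)
  have y: "((\<lambda>t. f (z + \<i> * of_real t) \<bullet> g (z + \<i> * of_real t)) has_vector_derivative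
      f z \<bullet> (\<i> * deriv g z) + (\<i> * deriv f z) \<bullet> g z) (at 0)" if "z \<in> D" for z
    using has_derivative_inner[OF
        has_vector_derivative_slices(2)[OF d(1)[OF that], unfolded has_vector_derivative_def]
        has_vector_derivative_slices(2)[OF d(2)[OF that], unfolded has_vector_derivative_def]]
    by (simp add: has_vector_derivative_def algebra_simps)
  show "partial_x (\<lambda>w. f w \<bullet> g w) z = f z \<bullet> deriv g z + deriv f z \<bullet> g z" if "z \<in> D"
    unfolding partial_x_def using x[OF that] by (rule vector_derivative_at)
  show "partial_y (\<lambda>w. f w \<bullet> g w) z = f z \<bullet> (\<i> * deriv g z) + (\<i> * deriv f z) \<bullet> g z" if "z \<in> D"
    unfolding partial_y_def using y[OF that] by (rule vector_derivative_at)
  show "partially_differentiable_on (\<lambda>w. f w \<bullet> g w) D"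
    unfolding partially_differentiable_on_def using x y differentiableI_vector by blast
qed

lemma differentiable_transform_nhds:
  assumes "k differentiable (at x)" "\<forall>\<^sub>F t in nhds x. k t = h t"
  shows "h differentiable (at x)"
proof -
  obtain k' where "(k has_derivative k') (at x)"
    using assms(1) by (auto simp: differentiable_def)
  moreover obtain T where "open T" "x \<in> T" "\<And>t. t \<in> T \<Longrightarrow> k t = h t"
    using assms(2) by (auto simp: eventually_nhds)
  ultimately have "(h has_derivative k') (at x)"
    by (rule has_derivative_transform_within_open)
  then show ?thesis by (auto simp: differentiable_def)
qed

lemma partially_differentiable_on_cong:
  assumes "open D" "\<And>w. w \<in> D \<Longrightarrow> h w = k w" "partially_differentiable_on k D"
  shows "partially_differentiable_on h D"
  unfolding partially_differentiable_on_def
proof (intro ballI conjI)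
  fix z assume z: "z \<in> D"
  have k: "(\<lambda>t. k (z + of_real t)) differentiable (at 0)"
    "(\<lambda>t. k (z + \<i> * of_real t)) differentiable (at 0)"
    using assms(3) z by (auto simp: partially_differentiable_on_def)
  show "(\<lambda>t. h (z + of_real t)) differentiable (at 0)"
    by (rule differentiable_transform_nhds[OF k(1)])
      (use slices_at_0(1)[OF assms(1) z] in eventually_elim, simp add: assms(2))
  show "(\<lambda>t. h (z + \<i> * of_real t)) differentiable (at 0)"
    by (rule differentiable_transform_nhds[OF k(2)])
      (use slices_at_0(2)[OF assms(1) z] in eventually_elim, simp add: assms(2))
qed

text \<open>Pythagoras: \<open>v\<close> and \<open>\<i> v\<close> are orthogonal and of the same length. This turns the
  directional quantities in the gradient and in the Hessian into moduli.\<close>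

lemma inner_sq_add_inner_i_sq:
  fixes u v :: complex
  shows "(u \<bullet> v)\<^sup>2 + (u \<bullet> (\<i> * v))\<^sup>2 = (cmod u)\<^sup>2 * (cmod v)\<^sup>2"
  unfolding inner_complex_def cmod_power2 by (simp add: power2_eq_square algebra_simps)

text \<open>Since \<open>\<bar>F\<bar> = f \<bullet> f\<close> is smooth even at the zeros of \<open>F\<close>, every partial derivative is an inner
  product of holomorphic functions, where \<open>\<partial>/\<partial>y\<close> acts on a holomorphic function as \<open>\<i>\<close> times its
  derivative. The diagonal Hessian entries are \<open>2 (\<bar>f'\<bar>\<^sup>2 \<plusminus> f \<bullet> f'')\<close> and the mixed one is
  \<open>2 (f \<bullet> \<i> f'')\<close>, so the two inner products combine to \<open>\<bar>f f''\<bar>\<^sup>2\<close> in the determinant.\<close>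

lemma gauss_curvature_modular_surface_square:
  assumes "open D" "f holomorphic_on D" "\<And>w. w \<in> D \<Longrightarrow> F w = (f w)\<^sup>2" "z \<in> D"
    and nondeg: "4 * (cmod (f z * deriv f z))\<^sup>2 \<noteq> 1"
  shows "gauss_curvature (modular_surface F) z =
    - 4 * ((cmod (deriv f z)) ^ 4 - (cmod (f z * deriv (deriv f) z))\<^sup>2)
      / (1 - 4 * (cmod (f z * deriv f z))\<^sup>2)\<^sup>2"
proof -
  define h where "h = (\<lambda>w. cmod (F w))"
  have f': "deriv f holomorphic_on D" and if': "(\<lambda>w. 2 * deriv f w) holomorphic_on D"
    "(\<lambda>w. 2 * (\<i> * deriv f w)) holomorphic_on D"
    using assms(1,2) by (auto intro!: holomorphic_intros holomorphic_deriv)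
  have d: "deriv (\<lambda>w. 2 * deriv f w) w = 2 * deriv (deriv f) w"
    "deriv (\<lambda>w. 2 * (\<i> * deriv f w)) w = 2 * (\<i> * deriv (deriv f) w)" if "w \<in> D" for w
    using holomorphic_derivI[OF f' assms(1) that]
    by (auto intro!: DERIV_imp_deriv derivative_eq_intros)
  have h: "h w = f w \<bullet> f w" if "w \<in> D" for w
    using assms(3)[OF that] by (simp add: h_def norm_power power2_norm_eq_inner)
  have hx: "partial_x h w = f w \<bullet> (2 * deriv f w)"
    and hy: "partial_y h w = f w \<bullet> (2 * (\<i> * deriv f w))" if "w \<in> D" for w
    using partial_cong[OF assms(1) that h] partials_inner(1,2)[OF assms(1,2,2) that]
    by (simp_all add: inner_complex_def algebra_simps)
  note I = partials_inner[OF assms(1,2)]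
  have hxx: "partial_x (partial_x h) z =
      2 * ((cmod (deriv f z))\<^sup>2 + f z \<bullet> deriv (deriv f) z)"
  proof -
    have "partial_x (partial_x h) z = partial_x (\<lambda>w. f w \<bullet> (2 * deriv f w)) z"
      by (rule partial_cong(1)[OF assms(1,4) hx])
    also have "\<dots> = f z \<bullet> (2 * deriv (deriv f) z) + deriv f z \<bullet> (2 * deriv f z)"
      using I(1)[OF if'(1) assms(4)] d(1)[OF assms(4)] by simp
    finally show ?thesis
      unfolding inner_complex_def cmod_power2 by (simp add: power2_eq_square algebra_simps)
  qed
  have hxy: "partial_y (partial_x h) z = 2 * (f z \<bullet> (\<i> * deriv (deriv f) z))"
  proof -
    have "partial_y (partial_x h) z = partial_y (\<lambda>w. f w \<bullet> (2 * deriv f w)) z"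
      by (rule partial_cong(2)[OF assms(1,4) hx])
    also have "\<dots> =
        f z \<bullet> (\<i> * (2 * deriv (deriv f) z)) + (\<i> * deriv f z) \<bullet> (2 * deriv f z)"
      using I(2)[OF if'(1) assms(4)] d(1)[OF assms(4)] by simp
    finally show ?thesis
      unfolding inner_complex_def by (simp add: algebra_simps)
  qed
  have hyy: "partial_y (partial_y h) z =
      2 * ((cmod (deriv f z))\<^sup>2 - f z \<bullet> deriv (deriv f) z)"
  proof -
    have "partial_y (partial_y h) z = partial_y (\<lambda>w. f w \<bullet> (2 * (\<i> * deriv f w))) z"
      by (rule partial_cong(2)[OF assms(1,4) hy])
    also have "\<dots> = f z \<bullet> (\<i> * (2 * (\<i> * deriv (deriv f) z)))
        + (\<i> * deriv f z) \<bullet> (2 * (\<i> * deriv f z))"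
      using I(2)[OF if'(2) assms(4)] d(2)[OF assms(4)] by simp
    finally show ?thesis
      unfolding inner_complex_def cmod_power2 by (simp add: power2_eq_square algebra_simps)
  qed
  have grad: "(partial_x h z)\<^sup>2 + (partial_y h z)\<^sup>2 = 4 * (cmod (f z * deriv f z))\<^sup>2"
    using inner_sq_add_inner_i_sq[of "f z" "2 * deriv f z"]
    by (simp add: hx[OF assms(4)] hy[OF assms(4)] norm_mult power_mult_distrib mult.left_commute)
  have det: "partial_x (partial_x h) z * partial_y (partial_y h) z - (partial_y (partial_x h) z)\<^sup>2
      = 4 * (cmod (deriv f z) ^ 4 - (cmod (f z * deriv (deriv f) z))\<^sup>2)"
    using inner_sq_add_inner_i_sq[of "f z" "deriv (deriv f) z"]
    unfolding hxx hxy hyy norm_mult power_mult_distrib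
    by (simp add: power2_eq_square power4_eq_xxxx algebra_simps)
  have "gauss_curvature (modular_surface F) z =
    - (partial_x (partial_x h) z * partial_y (partial_y h) z - (partial_y (partial_x h) z)\<^sup>2)
      / (1 - (partial_x h z)\<^sup>2 - (partial_y h z)\<^sup>2)\<^sup>2"
    unfolding modular_surface_def h_def[symmetric]
  proof (rule gauss_curvature_graph[OF assms(1,4)])
    show "partially_differentiable_on h D" "partially_differentiable_on (partial_x h) D"
      "partially_differentiable_on (partial_y h) D"
      using partially_differentiable_on_cong[OF assms(1) h I(3)[OF assms(2)]]
        partially_differentiable_on_cong[OF assms(1) hx I(3)[OF if'(1)]]
        partially_differentiable_on_cong[OF assms(1) hy I(3)[OF if'(2)]] by auto
    show "(partial_x h z)\<^sup>2 + (partial_y h z)\<^sup>2 \<noteq> 1"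
      using grad nondeg by simp
  qed
  also have "1 - (partial_x h z)\<^sup>2 - (partial_y h z)\<^sup>2 = 1 - 4 * (cmod (f z * deriv f z))\<^sup>2"
    using grad by simp
  finally show ?thesis unfolding det by simp
qed

section \<open>The differential equation of a flat modular surface\<close>

lemma norm_one_imp_constant:
  assumes "open S" "connected S" "q holomorphic_on S" "\<And>z. z \<in> S \<Longrightarrow> cmod (q z) = 1"
  obtains c where "\<And>z. z \<in> S \<Longrightarrow> q z = c"
proof (cases "S = {}")
  case False
  then obtain z where "z \<in> S" by blast
  with maximum_modulus_principle[OF assms(3,1,2,1) order_refl, of z] assms(4)
  have "q constant_on S" by auto
  then show ?thesis using that by (auto simp: constant_on_def)
qed (use that in auto)

text \<open>The quotient \<open>f f'' / f'\<^sup>2\<close> is used only on a disc away from the zeros of \<open>f'\<close>. The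
  resulting identity is cleared of denominators before it is continued analytically, and in this
  form it extends across the zeros of \<open>f'\<close>.\<close>

lemma eq_linear_mult_deriv:
  assumes "open D" "connected D" "f holomorphic_on D"
    and eq: "\<And>z. z \<in> D \<Longrightarrow> (cmod (deriv f z))\<^sup>2 = cmod (f z * deriv (deriv f) z)"
    and z0: "z0 \<in> D" "deriv f z0 \<noteq> 0"
  obtains c d where "cmod c = 1" "\<And>z. z \<in> D \<Longrightarrow> f z = ((1 - c) * z + d) * deriv f z"
proof -
  have f': "deriv f holomorphic_on D" and f'': "deriv (deriv f) holomorphic_on D"
    using assms(1,3) by (auto intro!: holomorphic_deriv)
  have "continuous_on D (deriv f)" using f' by (rule holomorphic_on_imp_continuous_on)
  then have "open (D \<inter> deriv f -` (- {0}))"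
    using assms(1) by (intro continuous_open_preimage) auto
  then obtain r where r: "r > 0" "ball z0 r \<subseteq> D \<inter> deriv f -` (- {0})"
    using z0 by (force elim!: openE)
  let ?B = "ball z0 r"
  have B: "?B \<subseteq> D" "\<And>z. z \<in> ?B \<Longrightarrow> deriv f z \<noteq> 0" using r by auto
  define q where "q = (\<lambda>z. f z * deriv (deriv f) z / (deriv f z)\<^sup>2)"
  have "q holomorphic_on ?B"
    unfolding q_def using assms(3) f' f'' B
    by (intro holomorphic_intros) (auto intro: holomorphic_on_subset)
  moreover have "cmod (q z) = 1" if "z \<in> ?B" for z
    using eq[of z] B that by (auto simp: q_def norm_divide norm_power)
  ultimately obtain c where c: "\<And>z. z \<in> ?B \<Longrightarrow> q z = c" "cmod c = 1"
    using norm_one_imp_constant[of ?B q] r(1) by (metis centre_in_ball connected_ball open_ball)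
  (* (f/f')' = 1 - f f''/f'^2 = 1 - c *)
  have "(\<lambda>z. f z / deriv f z - (1 - c) * z) constant_on ?B"
  proof (rule has_field_derivative_0_imp_constant_on)
    fix z assume z: "z \<in> ?B"
    have "(f has_field_derivative deriv f z) (at z)"
      "(deriv f has_field_derivative deriv (deriv f) z) (at z)"
      using z B assms(1,3) f' by (auto intro: holomorphic_derivI)
    moreover have "(deriv f z * deriv f z - f z * deriv (deriv f) z) / (deriv f z * deriv f z) = 1 - c"
      using c(1)[OF z] B(2)[OF z] by (simp add: q_def field_simps power2_eq_square)
    ultimately show "((\<lambda>z. f z / deriv f z - (1 - c) * z) has_field_derivative 0) (at z)"
      using B(2)[OF z] by (auto intro!: derivative_eq_intros)
  qed auto
  then obtain d where d: "\<And>z. z \<in> ?B \<Longrightarrow> f z / deriv f z - (1 - c) * z = d"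
    by (auto simp: constant_on_def)
  have eqB: "f z = ((1 - c) * z + d) * deriv f z" if "z \<in> ?B" for z
    using d[OF that] B(2)[OF that] by (simp add: field_simps)
  have "f z = ((1 - c) * z + d) * deriv f z" if "z \<in> D" for z
    by (rule analytic_continuation_open[OF _ assms(1) _ assms(2) B(1) assms(3) _ eqB that])
      (use r f' in \<open>auto intro!: holomorphic_intros\<close>)
  with c(2) that show ?thesis by blast
qed

section \<open>Branches of complex powers\<close>

text \<open>The equation says that \<open>P'/P = a g'/g\<close>. On a disc \<open>g\<close> has a logarithm \<open>L\<close>, and \<open>P exp (-a L)\<close>
  is constant there. If at one point of the disc \<open>P = exp (a u)\<close> for some logarithm \<open>u\<close> of \<open>g\<close>, then
  \<open>u\<close> differs from \<open>L\<close> by a period of \<open>exp\<close>, and shifting \<open>L\<close> by this period represents \<open>P\<close> on the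
  whole disc. Connectedness does the rest; going around a hole of \<open>D\<close> may change \<open>u\<close>, which the
  pointwise statement tolerates.\<close>

lemma power_branch_propagates:
  assumes "open D" "connected D" "g holomorphic_on D" "P holomorphic_on D"
    and nz: "\<And>z. z \<in> D \<Longrightarrow> g z \<noteq> 0"
    and ode: "\<And>z. z \<in> D \<Longrightarrow> deriv P z * g z = a * deriv g z * P z"
    and start: "z0 \<in> D" "P z0 \<in> cpower_values (g z0) a"
    and "z \<in> D"
  shows "P z \<in> cpower_values (g z) a"
proof (rule connected_induction_simple[where P = "\<lambda>z. P z \<in> cpower_values (g z) a",
      OF assms(2) start(1) \<open>z \<in> D\<close> start(2)])
  fix b assume "b \<in> D"
  then obtain r where r: "r > 0" "ball b r \<subseteq> D" using assms(1) by (auto elim: openE)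
  let ?B = "ball b r"
  have gB: "g holomorphic_on ?B" using assms(3) r by (auto intro: holomorphic_on_subset)
  obtain L where L: "L holomorphic_on ?B" "\<And>x. x \<in> ?B \<Longrightarrow> exp (L x) = g x"
    using holomorphic_logarithm_exists[of ?B g b] gB nz r by (auto simp: subset_iff)
  have "(\<lambda>w. P w * exp (- a * L w)) constant_on ?B"
  proof (rule has_field_derivative_0_imp_constant_on)
    fix w assume w: "w \<in> ?B"
    have dP: "(P has_field_derivative deriv P w) (at w)"
      using w r assms(1,4) by (auto intro: holomorphic_derivI)
    have dL: "(L has_field_derivative deriv L w) (at w)"
      using w L by (auto intro: holomorphic_derivI)
    have "((\<lambda>w. exp (L w)) has_field_derivative g w * deriv L w) (at w)"
      using dL L(2)[OF w] by (auto intro!: derivative_eq_intros)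
    then have "(g has_field_derivative g w * deriv L w) (at w)"
      by (rule has_field_derivative_transform_within_open[of _ _ _ ?B]) (use w L in auto)
    then have "deriv g w = g w * deriv L w" by (rule DERIV_imp_deriv)
    then have "deriv P w = a * deriv L w * P w"
      using ode[of w] nz[of w] w r by (auto simp: algebra_simps)
    then show "((\<lambda>w. P w * exp (- a * L w)) has_field_derivative 0) (at w)"
      using dP dL by (auto intro!: derivative_eq_intros)
  qed auto
  then obtain k where k: "\<And>w. w \<in> ?B \<Longrightarrow> P w * exp (- a * L w) = k"
    by (auto simp: constant_on_def)
  have propagate: "P y \<in> cpower_values (g y) a"
    if x: "x \<in> ?B" "P x \<in> cpower_values (g x) a" and y: "y \<in> ?B" for x y
  proof -
    have gxy: "g x \<noteq> 0" "g y \<noteq> 0" using x y nz r by auto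
    then obtain u where u: "exp u = g x" "P x = exp (a * u)"
      using x(2) by (auto simp: cpower_values_def)
    (* L shifted by the period u - L x, so that it agrees with u at x *)
    define v where "v = L y + (u - L x)"
    have "exp v = g y"
      using u(1) L(2)[OF x(1)] L(2)[OF y] gxy by (simp add: v_def exp_add exp_diff)
    moreover have "P y = k * exp (a * L y)"
      using k[OF y] by (auto simp: exp_minus field_simps)
    then have "P y = exp (a * v)"
      using k[OF x(1)] u(2) by (auto simp: v_def exp_add exp_diff exp_minus field_simps)
    ultimately show ?thesis using gxy by (auto simp: cpower_values_def)
  qed
  show "\<exists>T. openin (top_of_set D) T \<and> b \<in> T \<and>
      (\<forall>x\<in>T. \<forall>y\<in>T. P x \<in> cpower_values (g x) a \<longrightarrow> P y \<in> cpower_values (g y) a)"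
  proof (intro exI conjI ballI impI)
    show "openin (top_of_set D) ?B" using r(2) by (intro open_subset) auto
    show "b \<in> ?B" using r(1) by simp
  qed (rule propagate)
qed

lemma solution_is_exponential:
  assumes "open D" "connected D" "P holomorphic_on D" "\<And>z. z \<in> D \<Longrightarrow> deriv P z = m * P z"
    "z0 \<in> D" "P z0 \<noteq> 0"
  obtains n where "\<And>z. z \<in> D \<Longrightarrow> P z = exp (m * z + n)"
proof -
  have "(\<lambda>z. P z * exp (- m * z)) constant_on D"
  proof (rule has_field_derivative_0_imp_constant_on[OF _ assms(2,1)])
    fix z assume "z \<in> D"
    then have "(P has_field_derivative m * P z) (at z)"
      using holomorphic_derivI[OF assms(3,1)] assms(4) by metis
    then show "((\<lambda>z. P z * exp (- m * z)) has_field_derivative 0) (at z)"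
      by (auto intro!: derivative_eq_intros)
  qed
  then obtain k where k: "\<And>z. z \<in> D \<Longrightarrow> P z * exp (- m * z) = k"
    by (auto simp: constant_on_def)
  have "k \<noteq> 0" using k[OF assms(5)] assms(6) by auto
  show ?thesis
  proof
    fix z assume "z \<in> D"
    from k[OF this] have "P z = exp (m * z) * k" by (auto simp: exp_minus field_simps)
    then show "P z = exp (m * z + Ln k)" using \<open>k \<noteq> 0\<close> by (simp add: exp_add)
  qed
qed

text \<open>This is where the exponent \<open>1 + \<i> l\<close> comes from: \<open>Re (2 / (1 - c)) = 2 (1 - Re c) / \<bar>1 - c\<bar>\<^sup>2\<close>,
  and on the unit circle the denominator equals the numerator.\<close>

lemma Re_two_divide_one_minus_unit:
  assumes "cmod c = 1" "c \<noteq> 1"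
  shows "Re (2 / (1 - c)) = 1"
proof -
  have c: "(Re c)\<^sup>2 + (Im c)\<^sup>2 = 1" using assms(1) by (simp add: cmod_power2[symmetric])
  then have "(1 - Re c)\<^sup>2 + (Im c)\<^sup>2 = 2 * (1 - Re c)"
    by (simp add: power2_eq_square algebra_simps)
  moreover have "Re c \<noteq> 1" using c assms(2) by (auto simp: complex_eq_iff)
  ultimately show ?thesis by (simp add: Re_divide)
qed

text \<open>The equation determines \<open>P\<close> only up to a factor. Scaling the base \<open>p z + q\<close> by \<open>k\<close> leaves the
  equation unchanged and multiplies the power by values of \<open>k\<^sup>a\<close>, so \<open>k\<close> can be chosen to match
  \<open>P\<close> at one point. The zero of the base may lie in \<open>D\<close>; there the equation forces \<open>P = 0\<close>, and
  removing this point keeps \<open>D\<close> connected.\<close>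

lemma solution_is_power_branch:
  assumes "open D" "connected D" "P holomorphic_on D" "p \<noteq> 0"
    and a: "a \<noteq> 0"
    and ode: "\<And>z. z \<in> D \<Longrightarrow> (p * z + q) * deriv P z = a * p * P z"
    and z0: "z0 \<in> D" "p * z0 + q \<noteq> 0" "P z0 \<noteq> 0"
  obtains m n where "power_branch_on D (\<lambda>z. m * z + n) a P"
proof -
  (* chosen such that exp (a * u) = P z0; then k makes exp u the value of the base at z0 *)
  define u where "u = Ln (P z0) / a"
  define k where "k = exp u / (p * z0 + q)"
  have k: "k \<noteq> 0" "k * (p * z0 + q) = exp u" using z0 by (auto simp: k_def)
  define g where "g = (\<lambda>z. k * p * z + k * q)"
  have g: "g z = k * (p * z + q)" for z by (simp add: g_def algebra_simps)
  have g0: "g z = 0 \<longleftrightarrow> z = - q / p" for z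
  proof -
    have "g z = 0 \<longleftrightarrow> p * z = - q"
      using k(1) by (simp add: g add_eq_0_iff2)
    also have "\<dots> \<longleftrightarrow> z = - q / p"
      using nonzero_eq_divide_eq[OF \<open>p \<noteq> 0\<close>, of z "- q"] by (simp add: mult.commute)
    finally show ?thesis .
  qed
  have dg: "deriv g z = k * p" for z
    unfolding g_def by (rule DERIV_imp_deriv) (auto intro!: derivative_eq_intros)
  have gh: "g holomorphic_on A" for A unfolding g_def by (intro holomorphic_intros)
  have start: "P z0 \<in> cpower_values (g z0) a"
    using z0 k a by (auto simp: cpower_values_def g u_def intro!: exI[of _ u])
  have "P z \<in> cpower_values (g z) a" if z: "z \<in> D" for z
  proof (cases "g z = 0")
    case True
    then have "p * z + q = 0" using g k(1) by simp
    then have "P z = 0" using ode[OF z] a \<open>p \<noteq> 0\<close> by simp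
    then show ?thesis using True by (simp add: cpower_values_def)
  next
    case False
    show ?thesis
    proof (rule power_branch_propagates[of "D - {- q / p}" g P a z0])
      show "open (D - {- q / p})" using assms(1) by (rule open_delete)
      show "connected (D - {- q / p})" using assms(1,2) by (intro connected_open_delete) auto
      show "P holomorphic_on D - {- q / p}" using assms(3) by (rule holomorphic_on_subset) auto
      show "deriv P w * g w = a * deriv g w * P w" if "w \<in> D - {- q / p}" for w
        using ode[of w] that unfolding dg unfolding g by (simp add: mult.commute mult.left_commute)
    qed (use z z0 False g0 gh start k in \<open>auto simp: g\<close>)
  qed
  then have "power_branch_on D g a P"
    using assms(1,3) by (simp add: power_branch_on_def analytic_on_open)
  then show ?thesis using that unfolding g_def by blast
qed

section \<open>Flat modular surfaces\<close>

theorem theorem3p4: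
  fixes D :: "complex set" and F f :: "complex \<Rightarrow> complex"
  assumes "open D" and "connected D"
    and "F analytic_on D" and "f analytic_on D"
    and "\<And>z. z \<in> D \<Longrightarrow> F z = (f z)\<^sup>2"
    and "\<And>z. z \<in> D \<Longrightarrow> cmod (deriv F z) \<noteq> 1"
    and "\<And>z. z \<in> D \<Longrightarrow> gauss_curvature (modular_surface F) z = 0"
  shows "\<exists>(m::complex) (n::complex) (l::real).
    (\<forall>z\<in>D. F z = exp (m * z + n)) \<or>
    power_branch_on D (\<lambda>z. m * z + n) (1 + \<i> * of_real l) F"
proof -
  have f: "f holomorphic_on D" and F: "F holomorphic_on D"
    using assms(1,3,4) by (auto simp: analytic_on_open)
  have dF: "deriv F z = 2 * f z * deriv f z" if "z \<in> D" for z
  proof -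
    have "((\<lambda>w. (f w)\<^sup>2) has_field_derivative 2 * f z * deriv f z) (at z)"
      using holomorphic_derivI[OF f assms(1) that] by (auto intro!: derivative_eq_intros)
    then have "(F has_field_derivative 2 * f z * deriv f z) (at z)"
      by (rule has_field_derivative_transform_within_open[of _ _ _ D]) (use assms that in auto)
    then show ?thesis by (rule DERIV_imp_deriv)
  qed
  have flat: "(cmod (deriv f z))\<^sup>2 = cmod (f z * deriv (deriv f) z)" if z: "z \<in> D" for z
  proof -
    have norm: "4 * (cmod (f z * deriv f z))\<^sup>2 = (cmod (deriv F z))\<^sup>2"
      by (simp add: dF[OF z] norm_mult power_mult_distrib)
    have ne: "4 * (cmod (f z * deriv f z))\<^sup>2 \<noteq> 1"
      using assms(6)[OF z] unfolding norm by (simp add: power2_eq_1_iff)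
        (metis norm_ge_zero not_one_le_zero neg_0_le_iff_le)
    then have "((cmod (deriv f z))\<^sup>2)\<^sup>2 = (cmod (f z * deriv (deriv f) z))\<^sup>2"
      using gauss_curvature_modular_surface_square[OF assms(1) f assms(5) z ne] assms(7)[OF z]
      by simp
    then show ?thesis by (rule power2_eq_imp_eq) auto
  qed
  show ?thesis
  proof (cases "\<forall>z\<in>D. deriv f z = 0")
    case True
    then have "F constant_on D"
      using has_field_derivative_0_imp_constant_on[OF _ assms(2,1), of F]
        holomorphic_derivI[OF F assms(1)] dF by (metis mult_zero_right)
    then obtain k where k: "\<And>z. z \<in> D \<Longrightarrow> F z = k" by (auto simp: constant_on_def)
    show ?thesis
    proof (cases "k = 0")
      case True
      (* the zero function is the power of the zero base *)
      then have "power_branch_on D (\<lambda>z. 0 * z + 0) (1 + \<i> * of_real 0) F"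
        using k assms(3) by (simp add: power_branch_on_def cpower_values_def)
      then show ?thesis by blast
    next
      case False
      then have "\<forall>z\<in>D. F z = exp (0 * z + Ln k)" using k by simp
      then show ?thesis by blast
    qed
  next
    case False
    then obtain z0 where z0: "z0 \<in> D" "deriv f z0 \<noteq> 0" by blast
    obtain c d where c: "cmod c = 1"
      and cd: "\<And>z. z \<in> D \<Longrightarrow> f z = ((1 - c) * z + d) * deriv f z"
      using eq_linear_mult_deriv[OF assms(1,2) f flat z0] by blast
    have ode: "((1 - c) * z + d) * deriv F z = 2 * F z" if "z \<in> D" for z
    proof -
      have "((1 - c) * z + d) * deriv F z = 2 * f z * (((1 - c) * z + d) * deriv f z)"
        using dF[OF that] by (simp only: mult_ac)
      also have "\<dots> = 2 * F z"
        using cd[OF that] assms(5)[OF that] by (simp only: power2_eq_square mult_ac)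
      finally show ?thesis .
    qed
    obtain z1 where z1: "z1 \<in> D" "f z1 \<noteq> 0"
    proof -
      have "\<not> (\<forall>z\<in>D. f z = 0)"
      proof
        assume "\<forall>z\<in>D. f z = 0"
        then have "(f has_field_derivative 0) (at z0)"
          using has_field_derivative_transform_within_open[of "\<lambda>_. 0" 0 z0 D f] assms(1) z0 by auto
        with z0(2) show False using DERIV_imp_deriv by blast
      qed
      then show ?thesis using that by blast
    qed
    then have F1: "F z1 \<noteq> 0" and g1: "(1 - c) * z1 + d \<noteq> 0"
      using assms(5) cd[of z1] by auto
    show ?thesis
    proof (cases "c = 1")
      case True
      with g1 have "d \<noteq> 0" by simp
      then have "deriv F z = (2 / d) * F z" if "z \<in> D" for z
        using ode[OF that] True by (simp add: field_simps)
      from solution_is_exponential[OF assms(1,2) F this z1(1) F1]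
      show ?thesis by metis
    next
      case c1: False
      define a where "a = 2 / (1 - c)"
      have a: "a \<noteq> 0" "a * (1 - c) = 2" "1 - c \<noteq> 0"
        unfolding a_def using c1 nonzero_eq_divide_eq[of "1 - c" "2 / (1 - c)" 2] by simp_all
      have ode': "((1 - c) * z + d) * deriv F z = a * (1 - c) * F z" if "z \<in> D" for z
        unfolding a(2) using that by (rule ode)
      obtain m n where mn: "power_branch_on D (\<lambda>z. m * z + n) a F"
        using solution_is_power_branch[OF assms(1,2) F a(3,1) ode' z1(1) g1 F1] by blast
      have "a = 1 + \<i> * of_real (Im a)"
        using Re_two_divide_one_minus_unit[OF c c1] by (simp add: a_def complex_eq_iff)
      with mn have "power_branch_on D (\<lambda>z. m * z + n) (1 + \<i> * of_real (Im a)) F"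
        by simp
      then show ?thesis by blast
    qed
  qed
qed

end
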